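(* Let $p_1,\ldots,p_n$ be relatively prime positive integers, let $p=(p_1,\ldots,p_n)$, and let $f^*_p$ be the Frobenius number of $p$. Let $I_{\mathcal L}$ be the lattice ideal and $\leq$ the term order defined in the context. Then $\mathrm{HF}_{\mathrm{in}_\leq(I_{\mathcal L})}(f^*_p)=0$ and $\mathrm{HF}_{\mathrm{in}_\leq(I_{\mathcal L})}(t)=1$ for all integers $t>f^*_p$. Consequently the index of regularity of the $p$-weighted Hilbert function of $\mathrm{in}_\leq(I_{\mathcal L})$ is $f^*_p+1$.
   Context: $\mathbb{N}$ includes $0$. "Relatively prime" means $\gcd(p_1,\ldots,p_n)=1$ (not necessarily pairwise coprime). An integer $t$ is $p$-representable if $t=v\cdot p$ for some $v\in\mathbb{N}^n$. The Frobenius number $f^*_p$ is the largest integer that is not $p$-representable (it exists). The $p$-degree of $v\in\mathbb{Z}^n$ is $v\cdot p$. For $v\in\mathbb{Z}^n$, $v^+\in\mathbb{N}^n$ is given by $v^+_i=\max(v_i,0)$ and $v^-:=(-v)^+$. For $v\in\mathbb{N}^n$, $x^v=x_1^{v_1}\cdots x_n^{v_n}$ in the polynomial ring $k[x_1,\ldots,x_n]$ over a field $k$. The lattice ideal is $I_{\mathcal L}=\langle x^{v^+}-x^{v^-} \mid v\in\mathbb{Z}^n,\ v\cdot p=0\rangle$. The term order $\leq$ first compares the $p$-degree of exponent vectors, and breaks ties by the reverse lexicographic order with $x_1<x_2<\cdots<x_n$: if $u\ne v$ have equal $p$-degree, then $x^u<x^v$ iff $u_i>v_i$ for the smallest index $i$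 with $u_i\neq v_i$. $\mathrm{in}_\leq(I_{\mathcal L})$ is the initial ideal. The $p$-weighted Hilbert function $\mathrm{HF}_I\colon\mathbb{N}\to\mathbb{N}$ of a monomial ideal $I$ is defined such that $\mathrm{HF}_I(t)$ is the number of monomials $x^m\notin I$ where $m$ has $p$-degree $t$. The index of regularity is the integer at which the Hilbert function becomes equal to a polynomial, i.e. the smallest $r\in\mathbb{N}$ such that there is a polynomial $P$ with $\mathrm{HF}_I(t)=P(t)$ for all integers $t\ge r$. *)

theory Defs
  imports
    "HOL-Library.Poly_Mapping"
    "HOL-Computational_Algebra.Polynomial"
begin

text \<open>
  The index type \<^typ>\<open>'n\<close> (finite, linearly ordered) stands for \<open>{1 < \<dots> < n}\<close>: the variables are
  \<open>x\<^sub>i\<close> for \<open>i :: 'n\<close>, with the order of the variables given by the order of \<open>'n\<close>.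
  Exponent vectors in \<open>\<nat>\<^sup>n\<close> are elements of \<^typ>\<open>'n \<Rightarrow>\<^sub>0 nat\<close>, lattice vectors in \<open>\<int>\<^sup>n\<close> elements of
  \<^typ>\<open>'n \<Rightarrow>\<^sub>0 int\<close> (finite support is automatic), and \<open>k[x\<^sub>1,\<dots>,x\<^sub>n]\<close> is the monoid algebra
  \<^typ>\<open>('n \<Rightarrow>\<^sub>0 nat) \<Rightarrow>\<^sub>0 'k\<close>, with convolution as multiplication.
\<close>

type_synonym ('n, 'k) mpoly = "('n \<Rightarrow>\<^sub>0 nat) \<Rightarrow>\<^sub>0 'k"

definition monomial :: "('n \<Rightarrow>\<^sub>0 nat) \<Rightarrow> ('n, 'k::comm_ring_1) mpoly" where
  "monomial u = Poly_Mapping.single u 1"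

definition ideal_generated_by :: "('n, 'k::comm_ring_1) mpoly set \<Rightarrow> ('n, 'k) mpoly set" where
  "ideal_generated_by S = module.span (*) S"

definition p_degree :: "('n::finite \<Rightarrow> nat) \<Rightarrow> ('n \<Rightarrow>\<^sub>0 'a::comm_semiring_1) \<Rightarrow> 'a" where
  "p_degree p v = (\<Sum>i\<in>UNIV. Poly_Mapping.lookup v i * of_nat (p i))"

definition p_representable :: "('n::finite \<Rightarrow> nat) \<Rightarrow> int \<Rightarrow> bool" where
  "p_representable p t \<longleftrightarrow> (\<exists>v :: 'n \<Rightarrow>\<^sub>0 nat. t = int (p_degree p v))"

text \<open>The largest integer that is not representable; it is \<open>-1\<close> if some \<open>p i\<close> is \<open>1\<close>.\<close>

definition frobenius_number :: "('n::finite \<Rightarrow> nat) \<Rightarrow> int" where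
  "frobenius_number p = (GREATEST t. \<not> p_representable p t)"

text \<open>\<^const>\<open>nat\<close> truncates negative integers to \<open>0\<close>, so it computes \<open>max v\<^sub>i 0\<close>.\<close>

definition pos_part :: "('n \<Rightarrow>\<^sub>0 int) \<Rightarrow> ('n \<Rightarrow>\<^sub>0 nat)" where
  "pos_part v = Poly_Mapping.map nat v"

definition neg_part :: "('n \<Rightarrow>\<^sub>0 int) \<Rightarrow> ('n \<Rightarrow>\<^sub>0 nat)" where
  "neg_part v = pos_part (- v)"

definition lattice_ideal :: "('n::finite \<Rightarrow> nat) \<Rightarrow> ('n, 'k::comm_ring_1) mpoly set" where
  "lattice_ideal p =
     ideal_generated_by {monomial (pos_part v) - monomial (neg_part v) | v. p_degree p v = 0}"

definition term_less ::
  "('n::{finite,linorder} \<Rightarrow> nat) \<Rightarrow> ('n \<Rightarrow>\<^sub>0 nat) \<Rightarrow> ('n \<Rightarrow>\<^sub>0 nat) \<Rightarrow> bool" where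
  "term_less p u v \<longleftrightarrow>
     p_degree p u < p_degree p v \<or>
     (p_degree p u = p_degree p v \<and>
      (\<exists>i. Poly_Mapping.lookup u i > Poly_Mapping.lookup v i \<and> (\<forall>j<i. Poly_Mapping.lookup u j = Poly_Mapping.lookup v j)))"

definition initial_exponent ::
  "('n::{finite,linorder} \<Rightarrow> nat) \<Rightarrow> ('n, 'k::comm_ring_1) mpoly \<Rightarrow> ('n \<Rightarrow>\<^sub>0 nat)" where
  "initial_exponent p f =
     (THE u. u \<in> Poly_Mapping.keys f \<and> (\<forall>w\<in>Poly_Mapping.keys f. w \<noteq> u \<longrightarrow> term_less p w u))"

definition initial_ideal ::
  "('n::{finite,linorder} \<Rightarrow> nat) \<Rightarrow> ('n, 'k::comm_ring_1) mpoly set \<Rightarrow> ('n, 'k) mpoly set" where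
  "initial_ideal p I = ideal_generated_by {monomial (initial_exponent p f) | f. f \<in> I \<and> f \<noteq> 0}"

text \<open>
  The Hilbert function takes an integer argument (it vanishes at negative ones), so that its value
  at the Frobenius number makes sense even when the latter is \<open>-1\<close>.
\<close>

definition hilbert_function ::
  "('n::finite \<Rightarrow> nat) \<Rightarrow> ('n, 'k::comm_ring_1) mpoly set \<Rightarrow> int \<Rightarrow> nat" where
  "hilbert_function p I t = card {m. monomial m \<notin> I \<and> int (p_degree p m) = t}"

definition eventually_polynomial_from :: "(int \<Rightarrow> nat) \<Rightarrow> nat \<Rightarrow> bool" where
  "eventually_polynomial_from H r \<longleftrightarrow>
     (\<exists>P :: real poly. \<forall>t\<ge>int r. real (H t) = poly P (of_int t))"

definition is_index_of_regularity :: "(int \<Rightarrow> nat) \<Rightarrow> nat \<Rightarrow> bool" where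
  "is_index_of_regularity H r \<longleftrightarrow>
     eventually_polynomial_from H r \<and> (\<forall>s. eventually_polynomial_from H s \<longrightarrow> r \<le> s)"

end

theory Submission
  imports Defs "HOL-Library.FuncSet"
begin

text \<open>
  Two monomials are congruent modulo the lattice ideal iff they have the same \<open>p\<close>-degree, so in each
  degree only the smallest monomial is standard. Hence the Hilbert function at \<open>t\<close> is 1 or 0 according
  to whether \<open>t\<close> is representable, and a polynomial that is eventually 1 is constant.
\<close>

section \<open>Finiteness of the degree fibres\<close>

lemma p_degree_add: "p_degree p (u + v) = p_degree p u + p_degree p v"
  by (simp add: p_degree_def lookup_add algebra_simps sum.distrib)

lemma p_degree_zero [simp]: "p_degree p 0 = 0"
  by (simp add: p_degree_def)

text \<open>Positive weights bound every exponent by the degree, so a degree fibre embeds into the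
  finite set of functions from the index type to \<open>{..d}\<close>.\<close>

lemma finite_p_degree_eq:
  fixes p :: "'n::finite \<Rightarrow> nat"
  assumes "\<forall>i. 0 < p i"
  shows "finite {m :: 'n \<Rightarrow>\<^sub>0 nat. p_degree p m = d}"
proof -
  have "Poly_Mapping.lookup m i \<le> p_degree p m" for m :: "'n \<Rightarrow>\<^sub>0 nat" and i
  proof -
    have "Poly_Mapping.lookup m i \<le> Poly_Mapping.lookup m i * p i"
      using assms[rule_format, of i] by simp
    also have "\<dots> \<le> p_degree p m"
      unfolding p_degree_def
      using member_le_sum[of i UNIV "\<lambda>i. Poly_Mapping.lookup m i * of_nat (p i)"] by simp
    finally show ?thesis .
  qed
  then have "Poly_Mapping.lookup ` {m :: 'n \<Rightarrow>\<^sub>0 nat. p_degree p m = d} \<subseteq> UNIV \<rightarrow>\<^sub>E {..d}"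
    by fastforce
  moreover have "finite ((UNIV :: 'n set) \<rightarrow>\<^sub>E {..d})"
    by (rule finite_PiE) auto
  ultimately have "finite (Poly_Mapping.lookup ` {m :: 'n \<Rightarrow>\<^sub>0 nat. p_degree p m = d})"
    by (rule finite_subset)
  then show ?thesis
    by (rule finite_imageD) (simp add: inj_on_def)
qed

section \<open>The term order\<close>

lemma transp_term_less: "transp (term_less p)"
proof (rule transpI)
  fix u v w
  assume uv: "term_less p u v" and vw: "term_less p v w"
  show "term_less p u w"
  proof (cases "p_degree p u = p_degree p v \<and> p_degree p v = p_degree p w")
    case True
    then obtain i j
      where i: "Poly_Mapping.lookup u i > Poly_Mapping.lookup v i"
          "\<forall>l<i. Poly_Mapping.lookup u l = Poly_Mapping.lookup v l"
        and j: "Poly_Mapping.lookup v j > Poly_Mapping.lookup w j"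
          "\<forall>l<j. Poly_Mapping.lookup v l = Poly_Mapping.lookup w l"
      using uv vw by (auto simp: term_less_def)
    \<comment> \<open>Within one degree, the first index where \<open>u\<close> and \<open>w\<close>
      differ is the earlier of the two deciding indices.\<close>
    have "Poly_Mapping.lookup u (min i j) > Poly_Mapping.lookup w (min i j)"
      using i j by (cases i j rule: linorder_cases) (auto simp: min_def)
    moreover have "\<forall>l<min i j. Poly_Mapping.lookup u l = Poly_Mapping.lookup w l"
      using i j by simp
    ultimately show ?thesis
      using True by (auto simp: term_less_def)
  qed (use uv vw in \<open>auto simp: term_less_def\<close>)
qed

lemma asymp_term_less: "asymp (term_less p)"
proof (rule asympI)
  fix u v
  assume "term_less p u v"
  moreover have "\<not> term_less p u u"
    by (simp add: term_less_def)
  ultimately show "\<not> term_less p v u"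
    using transpD[OF transp_term_less] by blast
qed

lemma totalp_term_less: "totalp (term_less p)"
proof (rule totalpI)
  fix u v :: "'a \<Rightarrow>\<^sub>0 nat"
  assume "u \<noteq> v"
  \<comment> \<open>The index type is finite, so \<open>D\<close> has a minimum; this index breaks
    the tie between \<open>u\<close> and \<open>v\<close>.\<close>
  define D where "D = {i. Poly_Mapping.lookup u i \<noteq> Poly_Mapping.lookup v i}"
  have "D \<noteq> {}"
    using \<open>u \<noteq> v\<close> by (auto simp: D_def intro: poly_mapping_eqI)
  then have "Min D \<in> D"
    by simp
  moreover have "j \<notin> D" if "j < Min D" for j
    using that by (metis Min_le finite leD)
  ultimately obtain i where i: "Poly_Mapping.lookup u i \<noteq> Poly_Mapping.lookup v i"
      "\<forall>j<i. Poly_Mapping.lookup u j = Poly_Mapping.lookup v j"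
    unfolding D_def by blast
  show "term_less p u v \<or> term_less p v u"
  proof (cases "p_degree p u" "p_degree p v" rule: linorder_cases)
    case equal
    have i': "\<forall>j<i. Poly_Mapping.lookup v j = Poly_Mapping.lookup u j"
      using i(2) by simp
    from i(1) show ?thesis
      unfolding term_less_def neq_iff equal using i(2) i' by blast
  qed (simp_all add: term_less_def)
qed

lemma term_less_add_right: "term_less p u v \<Longrightarrow> term_less p (u + w) (v + w)"
  by (auto simp: term_less_def p_degree_add lookup_add)

section \<open>Ideals as submodules, and leading exponents\<close>

text \<open>Ideals are the submodules of the ring over itself, so the general lemmas on spans apply
  to generated ideals.\<close>

lemma module_times: "module ((*) :: 'a::comm_ring_1 \<Rightarrow> 'a \<Rightarrow> 'a)"
  by unfold_locales (simp_all add: algebra_simps)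

lemma initial_exponent_eqI:
  assumes "u \<in> Poly_Mapping.keys f" "\<And>w. w \<in> Poly_Mapping.keys f \<Longrightarrow> w \<noteq> u \<Longrightarrow> term_less p w u"
  shows "initial_exponent p f = u"
  unfolding initial_exponent_def
proof (rule the_equality)
  fix v
  assume "v \<in> Poly_Mapping.keys f \<and> (\<forall>w\<in>Poly_Mapping.keys f. w \<noteq> v \<longrightarrow> term_less p w v)"
  then show "v = u"
    using assms asympD[OF asymp_term_less[of p], of u v] by metis
qed (use assms in blast)

text \<open>The finite nonempty set of keys has a greatest element for the total transitive order,
  so the description in \<open>initial_exponent\<close> is proper.\<close>

lemma initial_exponent_greatest:
  fixes f :: "('n::{finite,linorder}, 'k::comm_ring_1) mpoly"
  assumes "f \<noteq> 0"
  shows "initial_exponent p f \<in> Poly_Mapping.keys f"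
    and "w \<in> Poly_Mapping.keys f \<Longrightarrow> w \<noteq> initial_exponent p f \<Longrightarrow> term_less p w (initial_exponent p f)"
proof -
  have "\<exists>u\<in>Poly_Mapping.keys f. \<forall>w\<in>Poly_Mapping.keys f. w \<noteq> u \<longrightarrow> term_less p w u"
    using assms transp_on_subset[OF transp_term_less] totalp_on_subset[OF totalp_term_less]
    by (intro Finite_Set.bex_greatest_element) auto
  then obtain u where u: "u \<in> Poly_Mapping.keys f"
      "\<forall>w\<in>Poly_Mapping.keys f. w \<noteq> u \<longrightarrow> term_less p w u"
    by blast
  then have "initial_exponent p f = u"
    by (intro initial_exponent_eqI) auto
  with u show "initial_exponent p f \<in> Poly_Mapping.keys f"
    "w \<in> Poly_Mapping.keys f \<Longrightarrow> w \<noteq> initial_exponent p f \<Longrightarrow> term_less p w (initial_exponent p f)"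
    by auto
qed

section \<open>Functionals that see only the degree\<close>

text \<open>For \<open>g d = t ^ d\<close> this is the image of \<open>f\<close> under \<open>x\<^sub>i \<mapsto> t ^ p i\<close>; arbitrary \<open>g\<close> replaces
  the polynomial ring in \<open>t\<close>.\<close>

definition degree_functional ::
  "('n::finite \<Rightarrow> nat) \<Rightarrow> (nat \<Rightarrow> 'k) \<Rightarrow> ('n, 'k::comm_ring_1) mpoly \<Rightarrow> 'k" where
  "degree_functional p g f = (\<Sum>u\<in>Poly_Mapping.keys f. Poly_Mapping.lookup f u * g (p_degree p u))"

lemma degree_functional_zero [simp]: "degree_functional p g 0 = 0"
  by (simp add: degree_functional_def)

lemma degree_functional_add:
  "degree_functional p g (f + h) = degree_functional p g f + degree_functional p g h"
  unfolding degree_functional_def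
  by (rule setsum_keys_plus_distrib[where f = "\<lambda>u a. a * g (p_degree p u)"]) (simp_all add: distrib_right)

lemma degree_functional_diff:
  "degree_functional p g (f - h) = degree_functional p g f - degree_functional p g h"
  using degree_functional_add[of p g "f - h" h] by simp

lemma degree_functional_sum:
  "degree_functional p g (sum F A) = (\<Sum>a\<in>A. degree_functional p g (F a))"
  by (induction A rule: infinite_finite_induct) (simp_all add: degree_functional_add)

lemma degree_functional_single:
  "degree_functional p g (Poly_Mapping.single u a) = a * g (p_degree p u)"
  by (simp add: degree_functional_def)

lemma sum_single_keys:
  "(\<Sum>u\<in>Poly_Mapping.keys f. Poly_Mapping.single u (Poly_Mapping.lookup f u)) = f"
  by (rule poly_mapping_eqI)
    (auto simp: lookup_sum lookup_single when_def in_keys_iff sum.delta)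

text \<open>Multiplication by a monomial with exponent \<open>a\<close> shifts all degrees by
  \<open>p_degree p a\<close>, which can be absorbed into \<open>g\<close>.\<close>

lemma degree_functional_mult:
  "degree_functional p g (c * f) =
     (\<Sum>a\<in>Poly_Mapping.keys c. Poly_Mapping.lookup c a * degree_functional p (\<lambda>d. g (p_degree p a + d)) f)"
proof -
  have "c * f = (\<Sum>a\<in>Poly_Mapping.keys c. \<Sum>b\<in>Poly_Mapping.keys f.
      Poly_Mapping.single (a + b) (Poly_Mapping.lookup c a * Poly_Mapping.lookup f b))"
    by (subst (1 2) sum_single_keys[symmetric]) (simp add: sum_product mult_single)
  then show ?thesis
    by (simp add: degree_functional_sum degree_functional_single degree_functional_def[of p _ f]
        p_degree_add sum_distrib_left mult.assoc)
qed

section \<open>Binomials of the lattice ideal\<close>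

lemma lookup_pos_part: "Poly_Mapping.lookup (pos_part v) i = nat (Poly_Mapping.lookup v i)"
  by (simp add: pos_part_def map.rep_eq when_def)

lemma lookup_neg_part: "Poly_Mapping.lookup (neg_part v) i = nat (- Poly_Mapping.lookup v i)"
  by (simp add: neg_part_def lookup_pos_part)

lemma p_degree_pos_part_neg_part:
  "p_degree p v = int (p_degree p (pos_part v)) - int (p_degree p (neg_part v))"
  unfolding p_degree_def lookup_pos_part lookup_neg_part
  by (auto simp: sum_subtractf[symmetric] left_diff_distrib[symmetric] intro!: sum.cong)

lemma degree_functional_lattice_ideal:
  fixes f :: "('n::finite, 'k::comm_ring_1) mpoly"
  assumes "f \<in> lattice_ideal p"
  shows "degree_functional p g f = 0"
proof -
  interpret R: module "(*) :: ('n, 'k) mpoly \<Rightarrow> _"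
    by (rule module_times)
  \<comment> \<open>Quantifying over all \<open>g\<close> at once makes \<open>?Z\<close> an ideal:
    multiplication only replaces \<open>g\<close> by its shifts.\<close>
  let ?Z = "{f :: ('n, 'k) mpoly. \<forall>g. degree_functional p g f = 0}"
  have "R.subspace ?Z"
    by (rule R.subspaceI) (auto simp: degree_functional_add degree_functional_mult)
  \<comment> \<open>Both parts of a lattice vector have the same degree, so their two values of
    \<open>g\<close> cancel.\<close>
  moreover have "monomial (pos_part v) - monomial (neg_part v) \<in> ?Z"
    if "p_degree p v = (0 :: int)" for v
    using that p_degree_pos_part_neg_part[of p v]
    by (simp add: degree_functional_diff monomial_def degree_functional_single)
  ultimately have "lattice_ideal p \<subseteq> ?Z"
    unfolding lattice_ideal_def ideal_generated_by_def by (intro R.span_minimal) auto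
  then show ?thesis
    using assms by blast
qed

text \<open>Taking out the greatest common monomial factor leaves a generator, the one of the
  lattice vector \<open>z\<close>, the difference of \<open>u\<close> and \<open>v\<close>.\<close>

lemma monomial_diff_mem_lattice_ideal:
  fixes u v :: "'n::finite \<Rightarrow>\<^sub>0 nat"
  assumes "p_degree p u = p_degree p v"
  shows "(monomial u - monomial v :: ('n, 'k::comm_ring_1) mpoly) \<in> lattice_ideal p"
proof -
  interpret R: module "(*) :: ('n, 'k) mpoly \<Rightarrow> _"
    by (rule module_times)
  define z where "z = Poly_Mapping.map int u - Poly_Mapping.map int v"
  \<comment> \<open>This is the coordinatewise minimum of \<open>u\<close> and \<open>v\<close>; the
    subtraction never truncates.\<close>
  define w where "w = u - pos_part z"
  have z: "Poly_Mapping.lookup z i = int (Poly_Mapping.lookup u i) - int (Poly_Mapping.lookup v i)" for i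
    by (simp add: z_def lookup_minus map.rep_eq when_def)
  have u: "u = w + pos_part z" and v: "v = w + neg_part z"
    by (rule poly_mapping_eqI;
        simp add: w_def lookup_add lookup_minus lookup_pos_part lookup_neg_part z)+
  have "p_degree p z = 0"
    using assms p_degree_pos_part_neg_part[of p z] by (subst (asm) u, subst (asm) v) (simp add: p_degree_add)
  then have "monomial w * (monomial (pos_part z) - monomial (neg_part z)) \<in> (lattice_ideal p :: ('n, 'k) mpoly set)"
    unfolding lattice_ideal_def ideal_generated_by_def
    by (intro R.span_scale R.span_base) auto
  then show ?thesis
    by (subst u, subst v) (simp add: monomial_def mult_single right_diff_distrib)
qed

section \<open>Exponents of the initial ideal\<close>

text \<open>A combinatorial description, free of polynomials, of the exponents whose monomials turn
  out to lie in the initial ideal.\<close>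

definition non_minimal :: "('n::{finite,linorder} \<Rightarrow> nat) \<Rightarrow> ('n \<Rightarrow>\<^sub>0 nat) \<Rightarrow> bool" where
  "non_minimal p m \<longleftrightarrow> (\<exists>m'. p_degree p m' = p_degree p m \<and> term_less p m' m)"

text \<open>Translation preserves both the degree equality and the order; hence the polynomials
  supported on such exponents form an ideal.\<close>

lemma non_minimal_add:
  assumes "non_minimal p m"
  shows "non_minimal p (w + m)"
proof -
  obtain m' where "p_degree p m' = p_degree p m" "term_less p m' m"
    using assms by (auto simp: non_minimal_def)
  then have "p_degree p (m' + w) = p_degree p (m + w)" "term_less p (m' + w) (m + w)"
    by (simp_all add: p_degree_add term_less_add_right)
  then show ?thesis
    unfolding non_minimal_def add.commute[of w] by blast
qed

text \<open>Otherwise the leading exponent would be the only key in its degree. The functional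
  extracting that degree would then return the nonzero leading coefficient, yet it vanishes on the
  lattice ideal.\<close>

lemma non_minimal_initial_exponent:
  fixes f :: "('n::{finite,linorder}, 'k::comm_ring_1) mpoly"
  assumes "f \<in> lattice_ideal p" "f \<noteq> 0"
  shows "non_minimal p (initial_exponent p f)"
proof (rule ccontr)
  let ?u = "initial_exponent p f"
  let ?g = "\<lambda>d. if d = p_degree p ?u then 1 else 0 :: 'k"
  assume "\<not> non_minimal p ?u"
  then have "p_degree p w \<noteq> p_degree p ?u" if "w \<in> Poly_Mapping.keys f" "w \<noteq> ?u" for w
    using initial_exponent_greatest(2)[OF assms(2) that] by (auto simp: non_minimal_def)
  then have "degree_functional p ?g f = (\<Sum>u\<in>Poly_Mapping.keys f. if u = ?u then Poly_Mapping.lookup f u else 0)"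
    unfolding degree_functional_def by (intro sum.cong) auto
  also have "\<dots> = Poly_Mapping.lookup f ?u"
    using initial_exponent_greatest(1)[OF assms(2)] by (simp add: sum.delta)
  finally show False
    using degree_functional_lattice_ideal[OF assms(1)] initial_exponent_greatest(1)[OF assms(2), of p]
    by (simp add: in_keys_iff)
qed

lemma monomial_mem_initial_ideal_iff:
  "(monomial m :: ('n::{finite,linorder}, 'k::comm_ring_1) mpoly) \<in> initial_ideal p (lattice_ideal p)
     \<longleftrightarrow> non_minimal p m"
proof
  interpret R: module "(*) :: ('n, 'k) mpoly \<Rightarrow> _"
    by (rule module_times)
  {
    \<comment> \<open>This set is an ideal containing all leading monomials of the lattice ideal,
      hence also the ideal they generate.\<close>
    let ?N = "{f :: ('n, 'k) mpoly. \<forall>m\<in>Poly_Mapping.keys f. non_minimal p m}"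
    have "R.subspace ?N"
    proof (rule R.subspaceI)
      fix c f :: "('n, 'k) mpoly"
      assume "f \<in> ?N"
      then show "c * f \<in> ?N"
        using keys_mult[of c f] non_minimal_add by fastforce
    qed (use keys_add in fastforce)+
    then have "(initial_ideal p (lattice_ideal p) :: ('n, 'k) mpoly set) \<subseteq> ?N"
      unfolding initial_ideal_def ideal_generated_by_def
      by (intro R.span_minimal) (auto simp: monomial_def non_minimal_initial_exponent)
    moreover assume "(monomial m :: ('n, 'k) mpoly) \<in> initial_ideal p (lattice_ideal p)"
    ultimately show "non_minimal p m"
      by (auto simp: monomial_def)
  }
  {
    assume "non_minimal p m"
    then obtain m' where m': "p_degree p m' = p_degree p m" "term_less p m' m"
      by (auto simp: non_minimal_def)
    \<comment> \<open>A binomial of the lattice ideal with leading exponent \<open>m\<close>; its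
      two terms cannot cancel since the exponents differ.\<close>
    let ?f = "monomial m - monomial m' :: ('n, 'k) mpoly"
    have "m \<noteq> m'"
      using m'(2) asympD[OF asymp_term_less[of p], of m m] by blast
    then have "m \<in> Poly_Mapping.keys ?f" and "Poly_Mapping.keys ?f \<subseteq> {m, m'}"
      by (auto simp: monomial_def in_keys_iff lookup_minus lookup_single when_def split: if_splits)
    then have "initial_exponent p ?f = m" and "?f \<noteq> 0"
      using m'(2) by (auto intro!: initial_exponent_eqI)
    moreover have "?f \<in> lattice_ideal p"
      by (rule monomial_diff_mem_lattice_ideal) (simp add: m')
    ultimately show "(monomial m :: ('n, 'k) mpoly) \<in> initial_ideal p (lattice_ideal p)"
      unfolding initial_ideal_def ideal_generated_by_def by (intro R.span_base CollectI exI[of _ ?f]) simp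
  }
qed

text \<open>A nonempty degree fibre is finite, so it has a least element, and this is its only
  standard exponent.\<close>

lemma hilbert_function_initial_lattice_ideal:
  fixes p :: "'n::{finite,linorder} \<Rightarrow> nat"
  assumes "\<forall>i. 0 < p i"
  shows "hilbert_function p (initial_ideal p (lattice_ideal p) :: ('n, 'k::comm_ring_1) mpoly set) t
    = (if p_representable p t then 1 else 0)"
proof (cases "p_representable p t")
  case True
  then obtain v :: "'n \<Rightarrow>\<^sub>0 nat" where v: "t = int (p_degree p v)"
    by (auto simp: p_representable_def)
  let ?D = "{m :: 'n \<Rightarrow>\<^sub>0 nat. p_degree p m = p_degree p v}"
  have "\<exists>l\<in>?D. \<forall>m\<in>?D. m \<noteq> l \<longrightarrow> term_less p l m"
    using finite_p_degree_eq[OF assms]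
      transp_on_subset[OF transp_term_less] totalp_on_subset[OF totalp_term_less]
    by (intro Finite_Set.bex_least_element) auto
  then obtain l where l: "l \<in> ?D" "\<forall>m\<in>?D. m \<noteq> l \<longrightarrow> term_less p l m"
    by blast
  have "\<not> non_minimal p l"
    unfolding non_minimal_def using l asympD[OF asymp_term_less[of p], of _ l]
    by (metis (mono_tags, lifting) mem_Collect_eq)
  moreover have "non_minimal p m" if "m \<in> ?D" "m \<noteq> l" for m
    using l that by (auto simp: non_minimal_def)
  ultimately have "{m. \<not> non_minimal p m \<and> int (p_degree p m) = t} = {l}"
    using l(1) by (auto simp: v)
  then show ?thesis
    using True by (simp add: hilbert_function_def monomial_mem_initial_ideal_iff)
next
  case False
  then have "{m :: 'n \<Rightarrow>\<^sub>0 nat. \<not> non_minimal p m \<and> int (p_degree p m) = t} = {}"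
    by (auto simp: p_representable_def)
  then show ?thesis
    using False by (simp only: hilbert_function_def monomial_mem_initial_ideal_iff) simp
qed

section \<open>Representable integers and the Frobenius number\<close>

lemma p_representable_add:
  "p_representable p s \<Longrightarrow> p_representable p t \<Longrightarrow> p_representable p (s + t)"
  unfolding p_representable_def by (metis p_degree_add of_nat_add)

lemma p_representable_zero: "p_representable p 0"
  unfolding p_representable_def by (rule exI[of _ 0]) simp

lemma p_representable_mult: "p_representable p t \<Longrightarrow> p_representable p (int k * t)"
  by (induction k) (auto simp: p_representable_zero algebra_simps intro: p_representable_add)

lemma p_representable_nonneg: "p_representable p t \<Longrightarrow> 0 \<le> t"
  by (auto simp: p_representable_def)

text \<open>Induction with the Bezout identity for two integers: the old coefficients are scaled by
  \<open>y\<close> and the new element gets \<open>x\<close>.\<close>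

lemma bezout_finite_set:
  fixes p :: "'n \<Rightarrow> int"
  assumes "finite A"
  shows "\<exists>z :: 'n \<Rightarrow> int. (\<Sum>i\<in>A. z i * p i) = Gcd (p ` A)"
  using assms
proof (induction A)
  case (insert a A)
  then obtain z where z: "(\<Sum>i\<in>A. z i * p i) = Gcd (p ` A)"
    by blast
  obtain x y where "x * p a + y * Gcd (p ` A) = gcd (p a) (Gcd (p ` A))"
    using bezout_int by blast
  moreover have *: "(\<Sum>i\<in>A. (if i = a then x else y * z i) * p i) = y * (\<Sum>i\<in>A. z i * p i)"
    using insert.hyps by (auto simp: sum_distrib_left mult.assoc intro!: sum.cong)
  ultimately have "(\<Sum>i\<in>insert a A. (if i = a then x else y * z i) * p i) = Gcd (p ` insert a A)"
    using insert.hyps by (simp add: z[symmetric] *)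
  then show ?case
    by (rule exI[of _ "\<lambda>i. if i = a then x else y * z i"])
qed simp

text \<open>The positive and negative parts of a Bezout vector for 1 have degrees differing by
  exactly 1.\<close>

lemma p_representable_consecutive:
  assumes "Gcd (range p) = 1"
  shows "\<exists>b. p_representable p b \<and> p_representable p (b + 1)"
proof -
  obtain z where z: "(\<Sum>i\<in>UNIV. z i * int (p i)) = Gcd (range (\<lambda>i. int (p i)))"
    using bezout_finite_set[of UNIV "\<lambda>i. int (p i)"] by auto
  also have "\<dots> = 1"
    using assms Gcd_int_eq[of "range p"] by (simp add: image_image)
  finally have "p_degree p (Abs_poly_mapping z) = (1 :: int)"
    by (simp add: p_degree_def)
  then have "int (p_degree p (pos_part (Abs_poly_mapping z)))
      = int (p_degree p (neg_part (Abs_poly_mapping z))) + 1"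
    by (simp add: p_degree_pos_part_neg_part)
  then show ?thesis
    unfolding p_representable_def by metis
qed

text \<open>With \<open>b\<close> and \<open>b + 1\<close> representable and \<open>b\<close>
  positive, write \<open>t = q * b + r\<close> as \<open>(q - r) * b + r * (b + 1)\<close>.\<close>

lemma eventually_p_representable:
  assumes "Gcd (range p) = 1"
  shows "\<exists>N. \<forall>t\<ge>N. p_representable p t"
proof -
  obtain b where b: "p_representable p b" "p_representable p (b + 1)"
    using p_representable_consecutive[OF assms] by blast
  show ?thesis
  proof (cases "b = 0")
    \<comment> \<open>Here 1 itself is representable, hence so is every nonnegative integer.\<close>
    case True
    then show ?thesis
      using b p_representable_mult[of p 1] by (metis add_0 mult.right_neutral nat_0_le)
  next
    case False
    then have "0 < b"
      using p_representable_nonneg[OF b(1)] by simp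
    \<comment> \<open>The threshold makes the quotient at least \<open>b\<close>, which exceeds the
      remainder, so \<open>q - r\<close> is nonnegative.\<close>
    have "p_representable p t" if "b * b \<le> t" for t
    proof -
      define q r where "q = t div b" and "r = t mod b"
      have "0 \<le> r" "r < b" "b \<le> q"
        using \<open>0 < b\<close> that zdiv_mono1[of "b * b" t b] by (auto simp: q_def r_def)
      then have "p_representable p (int (nat (q - r)) * b + int (nat r) * (b + 1))"
        by (intro p_representable_add b[THEN p_representable_mult])
      also have "int (nat (q - r)) * b + int (nat r) * (b + 1) = t"
        using \<open>0 \<le> r\<close> \<open>r < b\<close> \<open>b \<le> q\<close> div_mult_mod_eq[of t b]
        by (simp add: q_def[symmetric] r_def[symmetric] algebra_simps)
      finally show ?thesis .
    qed
    then show ?thesis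
      by blast
  qed
qed

lemma frobenius_number:
  assumes "Gcd (range p) = 1"
  shows "\<not> p_representable p (frobenius_number p)"
    and "frobenius_number p < t \<Longrightarrow> p_representable p t"
proof -
  obtain N where N: "\<forall>t\<ge>N. p_representable p t"
    using eventually_p_representable[OF assms] by blast
  \<comment> \<open>Starting at -1, which is never representable, keeps \<open>?A\<close> nonempty
    even when every nonnegative integer is representable.\<close>
  let ?A = "{t. - 1 \<le> t \<and> t < N \<and> \<not> p_representable p t}"
  have "\<not> p_representable p (- 1)"
    using p_representable_nonneg[of p "- 1"] by auto
  then have "- 1 \<in> ?A"
    using N by (auto simp: not_le[symmetric])
  have "finite ?A"
    by (rule finite_subset[of _ "{- 1..<N}"]) auto
  have *: "\<not> p_representable p (Max ?A)"
    using Max_in[OF \<open>finite ?A\<close>] \<open>- 1 \<in> ?A\<close> by blast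
  have "t \<le> Max ?A" if "\<not> p_representable p t" for t
  proof (cases "- 1 \<le> t")
    case True
    then show ?thesis
      using that N \<open>finite ?A\<close> by (intro Max_ge) (auto simp: not_le[symmetric])
  next
    case False
    then show ?thesis
      using Max_ge[OF \<open>finite ?A\<close> \<open>- 1 \<in> ?A\<close>] by linarith
  qed
  note ** = this
  have "frobenius_number p = Max ?A"
    unfolding frobenius_number_def using * ** by (rule Greatest_equality)
  then show "\<not> p_representable p (frobenius_number p)"
    and "frobenius_number p < t \<Longrightarrow> p_representable p t"
    using * **[of t] by auto
qed

section \<open>The index of regularity\<close>

text \<open>Otherwise \<open>P - [:c:]\<close> would be a nonzero polynomial with infinitely many
  roots.\<close>

lemma poly_eq_const_of_eventually:
  fixes P :: "real poly"
  assumes "\<And>t :: int. t > N \<Longrightarrow> poly P (of_int t) = c"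
  shows "P = [:c:]"
proof (rule ccontr)
  assume "P \<noteq> [:c:]"
  then have "finite {x. poly (P - [:c:]) x = 0}"
    by (intro poly_roots_finite) simp
  moreover have "(of_int :: int \<Rightarrow> real) ` {N<..} \<subseteq> {x. poly (P - [:c:]) x = 0}"
    using assms by auto
  ultimately have "finite ((of_int :: int \<Rightarrow> real) ` {N<..})"
    by (rule rev_finite_subset)
  then have "finite {N<..}"
    by (rule finite_imageD) (auto simp: inj_on_def)
  then show False
    using infinite_Ioi by blast
qed

theorem mainTheorem5:
  fixes p :: "'n::{finite,linorder} \<Rightarrow> nat"
  assumes "\<forall>i. 0 < p i"
    and "Gcd (range p) = 1"
  shows "let I = (initial_ideal p (lattice_ideal p) :: ('n, 'k::field) mpoly set);
             HF = hilbert_function p I;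
             f = frobenius_number p
         in HF f = 0 \<and> (\<forall>t>f. HF t = 1) \<and>
            (\<exists>r. is_index_of_regularity HF r \<and> int r = f + 1)"
proof -
  define HF where "HF = hilbert_function p (initial_ideal p (lattice_ideal p) :: ('n, 'k) mpoly set)"
  define f where "f = frobenius_number p"
  have HF: "HF t = (if p_representable p t then 1 else 0)" for t
    unfolding HF_def using assms(1) by (rule hilbert_function_initial_lattice_ideal)
  have HF_f: "HF f = 0" and HF_gt: "\<forall>t>f. HF t = 1"
    using frobenius_number[OF assms(2)] by (auto simp: HF f_def)
  \<comment> \<open>Since -1 is not representable, \<open>f + 1\<close> is nonnegative and
    \<open>nat\<close> does not truncate it.\<close>
  have "- 1 \<le> f"
    using frobenius_number(2)[OF assms(2), of "- 1"] p_representable_nonneg[of p "- 1"]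
    by (fastforce simp: f_def)
  then have f: "int (nat (f + 1)) = f + 1"
    by simp
  have "is_index_of_regularity HF (nat (f + 1))"
    unfolding is_index_of_regularity_def
  proof (intro conjI allI impI)
    show "eventually_polynomial_from HF (nat (f + 1))"
      unfolding eventually_polynomial_from_def using HF_gt f by (intro exI[of _ "[:1:]"]) auto
  next
    fix s
    assume "eventually_polynomial_from HF s"
    then obtain P :: "real poly" where P: "\<forall>t\<ge>int s. real (HF t) = poly P (of_int t)"
      by (auto simp: eventually_polynomial_from_def)
    \<comment> \<open>Beyond both bounds \<open>HF\<close> is 1 and also agrees with
      \<open>P\<close>.\<close>
    then have "poly P (of_int t) = 1" if "t > max f (int s)" for t
      using HF_gt that by (metis less_imp_le max_less_iff_conj of_nat_1)
    then have "P = [:1:]"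
      by (rule poly_eq_const_of_eventually)
    \<comment> \<open>If \<open>s\<close> were at most \<open>f\<close>, then \<open>P\<close> would
      take the value \<open>HF f\<close>, which is 0, at \<open>f\<close>.\<close>
    then have "\<not> int s \<le> f"
      using P HF_f by force
    then show "nat (f + 1) \<le> s"
      by linarith
  qed
  with HF_f HF_gt f show ?thesis
    unfolding Let_def HF_def[symmetric] f_def[symmetric] by blast
qed

end
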